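(* Let $(P,\preceq)$ be a lattice, let $S=\{x_1,\ldots,x_n\}$ be a finite subset of $P$ with distinct elements such that $x_i\preceq x_j\Rightarrow i\leq j$, and let $f_1,\ldots,f_n:P\to\mathbb{C}$. Suppose that $S$ is meet closed, and let $k$ be the number of indices $i\in\{1,\ldots,n\}$ with $\Psi_{S,f_i}(x_i)=0$. Then the following hold for the row-adjusted meet matrix $(S)_{f_1,\ldots,f_n}=(f_i(x_i\wedge x_j))_{i,j=1}^n$. 1. $\mathrm{rank}\,(S)_{f_1,\ldots,f_n}=0$ if and only if $f_i(x_i\wedge x_j)=0$ for all $i,j=1,\ldots,n$. 2. If $k=0$, then $\mathrm{rank}\,(S)_{f_1,\ldots,f_n}=n$. 3. If $k>0$, then $n-k\leq\mathrm{rank}\,(S)_{f_1,\ldots,f_n}\leq n-1$.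
   Context: $S$ is meet closed if $x\wedge y\in S$ for all $x,y\in S$. For each $i=1,\ldots,n$ the function $\Psi_{S,f_i}:S\to\mathbb{C}$ is defined inductively by $$\Psi_{S,f_i}(x_k)=f_i(x_k)-\sum_{x_v\prec x_k}\Psi_{S,f_i}(x_v),$$ the sum being over $x_v\in S$; equivalently, $f_i(x_k)=\sum_{x_v\preceq x_k}\Psi_{S,f_i}(x_v)$ for all $k$. *)

theory Defs
  imports "Jordan_Normal_Form.DL_Rank"
begin

definition meet_closed :: "'a::lattice set \<Rightarrow> bool" where
  "meet_closed S \<longleftrightarrow> (\<forall>y\<in>S. \<forall>z\<in>S. inf y z \<in> S)"

text \<open>Only the values \<open>\<Psi>\<^bsub>S,f\<^esub>(y)\<close> with \<open>S\<close> finite and \<open>y \<in> S\<close> are meaningful; the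
  case distinction on finiteness only serves to make the recursion well-founded.\<close>

function Psi :: "'a::order set \<Rightarrow> ('a \<Rightarrow> complex) \<Rightarrow> 'a \<Rightarrow> complex" where
  "Psi S f y = (if finite S then f y - (\<Sum>z\<in>{z \<in> S. z < y}. Psi S f z) else 0)"
  by pat_completeness auto
termination
proof (relation "measure (\<lambda>(S, f, y). card {z \<in> S. z < y})")
  fix S :: "'a set" and f :: "'a \<Rightarrow> complex" and y z :: 'a
  assume "finite S" and "z \<in> {z \<in> S. z < y}"
  then have "{w \<in> S. w < z} \<subset> {w \<in> S. w < y}"
    by (auto intro: less_trans)
  with \<open>finite S\<close> have "card {w \<in> S. w < z} < card {w \<in> S. w < y}"
    by (intro psubset_card_mono) auto
  then show "((S, f, z), (S, f, y)) \<in> measure (\<lambda>(S, f, y). card {z \<in> S. z < y})"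
    by simp
qed simp

declare Psi.simps [simp del]

lemma Psi_rec:
  "finite S \<Longrightarrow> Psi S f y = f y - (\<Sum>z\<in>{z \<in> S. z < y}. Psi S f z)"
  by (subst Psi.simps) simp

lemma sum_Psi:
  assumes "finite S" and "y \<in> S"
  shows "f y = (\<Sum>z\<in>{z \<in> S. z \<le> y}. Psi S f z)"
proof -
  have "{z \<in> S. z \<le> y} = insert y {z \<in> S. z < y}"
    using \<open>y \<in> S\<close> by (auto simp: order_le_less)
  then show ?thesis
    using \<open>finite S\<close> Psi_rec[of S f y] by simp
qed

text \<open>Rows and columns are indexed by \<open>0, \<dots>, n - 1\<close>, and \<open>x i\<close>, \<open>f i\<close> stand for the
  \<open>(i + 1)\<close>-st element and function; their values at indices \<open>\<ge> n\<close> are irrelevant.\<close>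

definition row_adjusted_meet_matrix ::
    "nat \<Rightarrow> (nat \<Rightarrow> 'a::lattice) \<Rightarrow> (nat \<Rightarrow> 'a \<Rightarrow> complex) \<Rightarrow> complex mat" where
  "row_adjusted_meet_matrix n x f = mat n n (\<lambda>(i, j). f i (inf (x i) (x j)))"

end

theory Submission
  imports Defs
begin

text \<open>With \<open>A\<^sub>i\<^sub>v = \<Psi>\<^bsub>S,f\<^sub>i\<^esub>(x\<^sub>v)\<close> for \<open>x\<^sub>v \<le> x\<^sub>i\<close> (and \<open>0\<close> otherwise) and the incidence matrix
  \<open>E\<^sub>v\<^sub>j = [x\<^sub>v \<le> x\<^sub>j]\<close>, meet closedness gives the factorization \<open>(S)\<^bsub>f\<^sub>1,\<dots>,f\<^sub>n\<^esub> = A E\<close>. Here \<open>A\<close> is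
  lower triangular with diagonal \<open>\<Psi>\<^bsub>S,f\<^sub>i\<^esub>(x\<^sub>i)\<close> and \<open>E\<close> is upper unitriangular, so the determinant
  decides between rank \<open>n\<close> and rank \<open>\<le> n - 1\<close>. Adding \<open>1\<close> to the \<open>k\<close> zero diagonal entries of \<open>A\<close>
  makes the product invertible while changing only \<open>k\<close> of its rows, hence the rank by at most \<open>k\<close>.\<close>

text \<open>A nonzero column forms by itself a linearly independent set of columns, which forces the
  rank to be at least 1.\<close>

lemma (in vec_space) rank_eq_0_iff:
  assumes A: "A \<in> carrier_mat n nc"
  shows "rank A = 0 \<longleftrightarrow> A = 0\<^sub>m n nc"
proof
  assume r: "rank A = 0"
  have "col A j = 0\<^sub>v n" if j: "j < nc" for j
  proof (rule ccontr)
    assume nz: "col A j \<noteq> 0\<^sub>v n"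
    have c: "col A j \<in> carrier_vec n"
      using A j by auto
    have "col A j \<notin> span {}"
      using nz by (simp add: span_empty)
    moreover have "lin_indpt {}"
      by (auto simp: lin_dep_def)
    ultimately have "lin_indpt {col A j}"
      using lin_dep_iff_in_span[of "{}" "col A j"] c by auto
    moreover have "{col A j} \<subseteq> set (cols A)"
      using A j by (auto simp: cols_def)
    ultimately have "card {col A j} \<le> rank A"
      using rank_ge_card_indpt[OF A] by blast
    with r show False by simp
  qed
  then show "A = 0\<^sub>m n nc"
    using A by (intro mat_col_eqI) auto
qed (simp add: rank_0I)

text \<open>Induction on \<open>I\<close>: splitting off one row leaves a summand of rank at most 1,
  and rank is subadditive.\<close>

lemma (in vec_space) rank_le_card_nonzero_rows:
  assumes "finite I" and "A \<in> carrier_mat n nc"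
    and "\<And>i j. i < n \<Longrightarrow> j < nc \<Longrightarrow> i \<notin> I \<Longrightarrow> A $$ (i, j) = 0"
  shows "rank A \<le> card I"
  using assms
proof (induction I arbitrary: A rule: finite_induct)
  case empty
  then have "A = 0\<^sub>m n nc"
    by (intro eq_matI) auto
  then show ?case by (simp add: rank_0I)
next
  case (insert l I)
  define B where "B = mat n nc (\<lambda>(i, j). if i = l then A $$ (i, j) else 0)"
  define C where "C = mat n nc (\<lambda>(i, j). if i = l then 0 else A $$ (i, j))"
  have carr: "B \<in> carrier_mat n nc" "C \<in> carrier_mat n nc"
    by (simp_all add: B_def C_def)
  have "A = B + C"
    using insert.prems(1) by (intro eq_matI) (auto simp: B_def C_def)
  then have "rank A \<le> rank B + rank C"
    using rank_subadditive[OF carr] by simp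
  \<comment> \<open>\<open>B\<close> is the outer product of the unit vector at \<open>l\<close> and
    row \<open>l\<close> of \<open>A\<close>.\<close>
  also have "rank B \<le> 1"
    using carr(1)
    by (rule rank_le_1_product_entries[where f = "\<lambda>i. if i = l then 1 else 0"
          and g = "\<lambda>j. A $$ (l, j)"]) (auto simp: B_def)
  also have "rank C \<le> card I"
    using carr(2) insert.prems(2) by (intro insert.IH) (auto simp: C_def)
  finally show ?case using insert.hyps by simp
qed

context
  fixes n :: nat and x :: "nat \<Rightarrow> 'a::lattice"
  assumes inj: "inj_on x {..<n}"
    and ordered: "\<And>i j. i < n \<Longrightarrow> j < n \<Longrightarrow> x i \<le> x j \<Longrightarrow> i \<le> j"
begin

definition incidence_mat :: "complex mat" where
  "incidence_mat = mat n n (\<lambda>(v, j). if x v \<le> x j then 1 else 0)"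

definition Psi_mat :: "(nat \<Rightarrow> 'a \<Rightarrow> complex) \<Rightarrow> complex mat" where
  "Psi_mat f = mat n n (\<lambda>(i, v). if x v \<le> x i then Psi (x ` {..<n}) (f i) (x v) else 0)"

lemma incidence_mat_carrier [simp]: "incidence_mat \<in> carrier_mat n n"
  by (simp add: incidence_mat_def)

lemma Psi_mat_carrier [simp]: "Psi_mat f \<in> carrier_mat n n"
  by (simp add: Psi_mat_def)

text \<open>Source of both triangular shapes: it kills the entries of \<open>incidence_mat\<close>
  below the diagonal and those of \<open>Psi_mat f\<close> above it.\<close>

lemma index_less_imp_not_le: "j < i \<Longrightarrow> i < n \<Longrightarrow> \<not> x i \<le> x j"
  using ordered[of i j] by auto

lemma det_incidence_mat: "det incidence_mat = 1"
proof -
  have "upper_triangular incidence_mat"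
    by (intro upper_triangularI) (auto simp: incidence_mat_def index_less_imp_not_le)
  then have "det incidence_mat = prod_list (diag_mat incidence_mat)"
    using incidence_mat_carrier by (rule det_upper_triangular)
  also have "\<dots> = 1"
    unfolding prod_list_diag_prod by (intro prod.neutral) (auto simp: incidence_mat_def)
  finally show ?thesis .
qed

text \<open>The shift \<open>d\<close> is left general to serve twice: \<open>d = 0\<close> gives
  the determinant of the meet matrix, and the indicator of the vanishing diagonal entries gives an
  invertible matrix.\<close>

lemma det_Psi_mat_add_diag:
  "det (Psi_mat f + mat_diag n d) = (\<Prod>i<n. Psi (x ` {..<n}) (f i) (x i) + d i)"
proof -
  have "det (Psi_mat f + mat_diag n d) = prod_list (diag_mat (Psi_mat f + mat_diag n d))"
    by (intro det_lower_triangular[of n]) (auto simp: Psi_mat_def mat_diag_def index_less_imp_not_le)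
  also have "\<dots> = (\<Prod>i<n. Psi (x ` {..<n}) (f i) (x i) + d i)"
    unfolding prod_list_diag_prod by (intro prod.cong) (auto simp: Psi_mat_def mat_diag_def)
  finally show ?thesis .
qed

lemma row_adjusted_meet_matrix_factorization:
  assumes closed: "meet_closed (x ` {..<n})"
  shows "row_adjusted_meet_matrix n x f = Psi_mat f * incidence_mat"
proof (rule eq_matI)
  fix i j assume "i < dim_row (Psi_mat f * incidence_mat)" "j < dim_col (Psi_mat f * incidence_mat)"
  then have ij: "i < n" "j < n"
    by (simp_all add: Psi_mat_def incidence_mat_def)
  let ?S = "x ` {..<n}" and ?V = "{v. v < n \<and> x v \<le> x i \<and> x v \<le> x j}"
  \<comment> \<open>Meet closedness enters here: \<open>sum_Psi\<close> expands \<open>f i\<close>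
    only at points of \<open>?S\<close>.\<close>
  have "inf (x i) (x j) \<in> ?S"
    using closed ij by (auto simp: meet_closed_def)
  then have "f i (inf (x i) (x j)) = (\<Sum>z\<in>{z \<in> ?S. z \<le> inf (x i) (x j)}. Psi ?S (f i) z)"
    by (intro sum_Psi) auto
  also have "{z \<in> ?S. z \<le> inf (x i) (x j)} = x ` ?V"
    by auto
  also have "(\<Sum>z\<in>x ` ?V. Psi ?S (f i) z) = (\<Sum>v\<in>?V. Psi ?S (f i) (x v))"
    by (subst sum.reindex) (auto intro: inj_on_subset[OF inj])
  \<comment> \<open>The condition is a conjunction, so each summand is the product of an entry of
    \<open>Psi_mat f\<close> and one of \<open>incidence_mat\<close>.\<close>
  also have "\<dots> = (\<Sum>v\<in>{0..<n}. if x v \<le> x i \<and> x v \<le> x j then Psi ?S (f i) (x v) else 0)"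
    by (intro sum.mono_neutral_cong_left) auto
  also have "\<dots> = (Psi_mat f * incidence_mat) $$ (i, j)"
    using ij by (auto simp: Psi_mat_def incidence_mat_def scalar_prod_def intro!: sum.cong)
  finally show "row_adjusted_meet_matrix n x f $$ (i, j) = (Psi_mat f * incidence_mat) $$ (i, j)"
    using ij by (simp add: row_adjusted_meet_matrix_def)
qed (simp_all add: row_adjusted_meet_matrix_def Psi_mat_def incidence_mat_def)

lemma det_row_adjusted_meet_matrix:
  assumes "meet_closed (x ` {..<n})"
  shows "det (row_adjusted_meet_matrix n x f) = (\<Prod>i<n. Psi (x ` {..<n}) (f i) (x i))"
proof -
  have "Psi_mat f + mat_diag n (\<lambda>_. 0) = Psi_mat f"
    by (intro eq_matI) (auto simp: Psi_mat_def mat_diag_def)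
  then have "det (Psi_mat f) = (\<Prod>i<n. Psi (x ` {..<n}) (f i) (x i))"
    using det_Psi_mat_add_diag[of f "\<lambda>_. 0"] by simp
  then show ?thesis
    by (simp add: row_adjusted_meet_matrix_factorization[OF assms]
        det_mult[OF Psi_mat_carrier incidence_mat_carrier] det_incidence_mat)
qed

lemma rank_row_adjusted_meet_matrix_ge:
  fixes f
  defines "I \<equiv> {i. i < n \<and> Psi (x ` {..<n}) (f i) (x i) = 0}"
  assumes "meet_closed (x ` {..<n})"
  shows "n - card I \<le> vec_space.rank n (row_adjusted_meet_matrix n x f)"
proof -
  interpret vec_space "TYPE(complex)" n .
  define D :: "complex mat" where "D = mat_diag n (\<lambda>i. if i \<in> I then 1 else 0)"
  have D: "D \<in> carrier_mat n n"
    by (simp add: D_def mat_diag_def)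
  \<comment> \<open>Each factor of the determinant is 1 for \<open>i \<in> I\<close> and a nonzero
    value of \<open>Psi\<close> otherwise.\<close>
  have "det (Psi_mat f + D) \<noteq> 0"
    unfolding D_def det_Psi_mat_add_diag by (auto simp: I_def)
  then have "det ((Psi_mat f + D) * incidence_mat) \<noteq> 0"
    using D by (simp add: det_mult[of _ n] det_incidence_mat)
  then have "rank ((Psi_mat f + D) * incidence_mat) = n"
    using D
    by (intro low_rank_det_zero mult_carrier_mat[of _ n n] add_carrier_mat) simp_all
  then have "n = rank (Psi_mat f * incidence_mat + D * incidence_mat)"
    by (simp add: add_mult_distrib_mat[OF Psi_mat_carrier D incidence_mat_carrier])
  also have "\<dots> \<le> rank (Psi_mat f * incidence_mat) + rank (D * incidence_mat)"
    using D by (intro rank_subadditive[of _ n] mult_carrier_mat[of _ n n]) simp_all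
  \<comment> \<open>Left multiplication by \<open>D\<close> scales row \<open>i\<close> by its
    diagonal entry, so the rows outside \<open>I\<close> vanish.\<close>
  also have "rank (D * incidence_mat) \<le> card I"
    unfolding D_def mat_diag_mult_left[OF incidence_mat_carrier]
    by (rule rank_le_card_nonzero_rows[of _ _ n]) (simp_all add: I_def)
  finally show ?thesis
    by (simp add: row_adjusted_meet_matrix_factorization[OF assms(2)])
qed

end

theorem theorem4p1:
  fixes n k :: nat
    and x :: "nat \<Rightarrow> 'a::lattice"
    and S :: "'a set"
    and f :: "nat \<Rightarrow> 'a \<Rightarrow> complex"
  assumes S_def: "S = x ` {..<n}"
    and distinct: "inj_on x {..<n}"
    and ordered: "\<And>i j. i < n \<Longrightarrow> j < n \<Longrightarrow> x i \<le> x j \<Longrightarrow> i \<le> j"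
    and closed: "meet_closed S"
    and k_def: "k = card {i. i < n \<and> Psi S (f i) (x i) = 0}"
  shows "(vec_space.rank n (row_adjusted_meet_matrix n x f) = 0 \<longleftrightarrow>
           (\<forall>i<n. \<forall>j<n. f i (inf (x i) (x j)) = 0)) \<and>
         (k = 0 \<longrightarrow> vec_space.rank n (row_adjusted_meet_matrix n x f) = n) \<and>
         (k > 0 \<longrightarrow> n - k \<le> vec_space.rank n (row_adjusted_meet_matrix n x f) \<and>
           vec_space.rank n (row_adjusted_meet_matrix n x f) \<le> n - 1)"
proof -
  interpret vec_space "TYPE(complex)" n .
  let ?M = "row_adjusted_meet_matrix n x f"
  have M: "?M \<in> carrier_mat n n"
    by (simp add: row_adjusted_meet_matrix_def)
  have "?M = 0\<^sub>m n n \<longleftrightarrow> (\<forall>i<n. \<forall>j<n. f i (inf (x i) (x j)) = 0)"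
    by (auto simp: row_adjusted_meet_matrix_def mat_eq_iff)
  then have zero: "rank ?M = 0 \<longleftrightarrow> (\<forall>i<n. \<forall>j<n. f i (inf (x i) (x j)) = 0)"
    using rank_eq_0_iff[OF M] by simp
  have "det ?M = (\<Prod>i<n. Psi S (f i) (x i))"
    using det_row_adjusted_meet_matrix[OF distinct ordered] closed S_def by simp
  \<comment> \<open>The product vanishes exactly when one of its factors does, and \<open>k\<close>
    counts the vanishing factors.\<close>
  then have "det ?M = 0 \<longleftrightarrow> k > 0"
    by (auto simp: k_def card_gt_0_iff)
  then have "k = 0 \<Longrightarrow> rank ?M = n" "k > 0 \<Longrightarrow> rank ?M < n"
    using low_rank_det_zero[OF M] det_zero_low_rank[OF M] by auto
  moreover have "n - k \<le> rank ?M"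
    using rank_row_adjusted_meet_matrix_ge[OF distinct ordered] closed S_def k_def by simp
  ultimately show ?thesis
    using zero by auto
qed

end
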